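(* Let $\sigma = 1.94696\ldots$ be the largest real root of $x^4-2x^2-4x+1=0$. There exist real numbers $\alpha_1,\alpha_2$ such that $1,\alpha_1,\alpha_2$ are linearly independent over $\mathbb{Z}$ and such that for every integer vector $(m_1,m_2)\in\mathbb{Z}^2$ with $m_1\geqslant 0$, $m_2\geqslant 0$ and $\max(m_1,m_2)\geqslant 2^{200}$ one has $$\|m_1\alpha_1+m_2\alpha_2\|\geqslant \frac{1}{2^{300}(\max(m_1,m_2))^{\sigma}}.$$
   Context: For real $\xi$, $\|\xi\|$ denotes the distance from $\xi$ to the nearest integer. *)

theory Defs
  imports "HOL-Analysis.Analysis"
begin

definition nearest_int_dist :: "real \<Rightarrow> real" where
  "nearest_int_dist \<xi> = \<bar>\<xi> - of_int (round \<xi>)\<bar>"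

lemma nearest_int_dist_le: "nearest_int_dist \<xi> \<le> \<bar>\<xi> - of_int m\<bar>"
  unfolding nearest_int_dist_def by (rule round_diff_minimal)

definition sigma_exp :: real where
  "sigma_exp = Max {x::real. x ^ 4 - 2 * x\<^sup>2 - 4 * x + 1 = 0}"

text \<open>The set of roots is finite and nonempty, so the maximum above is meaningful.\<close>

lemma finite_sigma_roots: "finite {x::real. x ^ 4 - 2 * x\<^sup>2 - 4 * x + 1 = 0}"
proof -
  have "{x::real. x ^ 4 - 2 * x\<^sup>2 - 4 * x + 1 = 0} = {x. poly [:1, -4, -2, 0, 1:] x = 0}"
    by (auto simp: algebra_simps power2_eq_square power4_eq_xxxx)
  then show ?thesis
    using poly_roots_finite[of "[:1, -4, -2, 0, 1::real:]"] by simp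
qed

lemma sigma_root_exists:
  "\<exists>x::real. 1.94696 \<le> x \<and> x \<le> 1.94697 \<and> x ^ 4 - 2 * x\<^sup>2 - 4 * x + 1 = 0"
  by (rule IVT') (auto intro!: continuous_intros simp: power2_eq_square power4_eq_xxxx)

lemma sigma_root: "sigma_exp ^ 4 - 2 * sigma_exp\<^sup>2 - 4 * sigma_exp + 1 = 0"
  using Max_in[OF finite_sigma_roots] sigma_root_exists unfolding sigma_exp_def by blast

lemma sigma_greatest: "x ^ 4 - 2 * x\<^sup>2 - 4 * x + 1 = 0 \<Longrightarrow> x \<le> sigma_exp"
  unfolding sigma_exp_def by (rule Max_ge[OF finite_sigma_roots]) simp

end

theory Submission
  imports Defs
begin

text \<open>
  The point \<open>(\<alpha>\<^sub>1, \<alpha>\<^sub>2)\<close> is a limit of rational points \<open>(p\<^sub>1/q, p\<^sub>2/q)\<close>, each encoded by a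
  primitive vector \<open>P = (q, p\<^sub>1, p\<^sub>2)\<close>. Consecutive points satisfy \<open>P \<times> P' = w\<close> with
  \<open>w\<^sub>1 < 0 < w\<^sub>2\<close>, so both coordinates increase, by amounts comparable to \<open>\<eta> = |w| / (q q')\<close>.
  Let \<open>m = (m\<^sub>0, m\<^sub>1, m\<^sub>2)\<close> with \<open>m\<^sub>1, m\<^sub>2 \<ge> 0\<close>, \<open>M = max m\<^sub>1 m\<^sub>2\<close> and
  \<open>L = m\<^sub>0 + m\<^sub>1 \<alpha>\<^sub>1 + m\<^sub>2 \<alpha>\<^sub>2\<close>.
  If \<open>m \<cdot> P \<noteq> 0\<close> and \<open>M \<eta>\<close> is small against \<open>1/q\<close>, then \<open>|L| \<ge> 1/(2q)\<close>.
  If \<open>m \<cdot> P = 0\<close>, then \<open>L\<close> is of order \<open>M \<eta>\<close> since no cancellation can occur; moreover, for any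
  \<open>w\<close> as above orthogonal to \<open>P\<close>, \<open>q\<close> divides \<open>m\<^sub>1 w\<^sub>2 - m\<^sub>2 w\<^sub>1 > 0\<close>, which forces \<open>M\<close> to be at
  least of order \<open>q / |w|\<close>.

  With \<open>T\<close> running through \<open>256 ^ 2 ^ n\<close>, one keeps a vector \<open>w\<close> of size \<open>T^10\<close> for three steps while
  the denominators grow through \<open>T^15, T^24, T^26, T^30\<close>, and then replaces \<open>w\<close> by a vector of size
  \<open>T^20\<close> orthogonal to the last point. The two alternatives then give \<open>|L| \<ge> 2^-16 M^-1.9\<close> when the
  three points are used for \<open>M\<close> in \<open>[T^8, T^13)\<close>, \<open>[T^13, T^15)\<close> and \<open>[T^15, T^16)\<close>, and
  \<open>1.9 < \<sigma>\<close>.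

  If \<open>L = 0\<close> for an arbitrary integer vector \<open>m\<close>, then \<open>m \<cdot> P = 0\<close> for all late \<open>P\<close>, hence
  \<open>(m\<^sub>1, m\<^sub>2)\<close> is parallel to all late \<open>(w\<^sub>1, w\<^sub>2)\<close> and vanishes.
\<close>

section \<open>Lattice bases and the two moves on flags\<close>

datatype ivec = IVec (c0: int) (c1: int) (c2: int)

definition dot :: "ivec \<Rightarrow> ivec \<Rightarrow> int" where
  "dot u v = c0 u * c0 v + c1 u * c1 v + c2 u * c2 v"

definition cross :: "ivec \<Rightarrow> ivec \<Rightarrow> ivec" where
  "cross u v = IVec (c1 u * c2 v - c2 u * c1 v) (c2 u * c0 v - c0 u * c2 v) (c0 u * c1 v - c1 u * c0 v)"

definition lincomb :: "int \<Rightarrow> ivec \<Rightarrow> int \<Rightarrow> ivec \<Rightarrow> ivec" where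
  "lincomb a u b v = IVec (a * c0 u + b * c0 v) (a * c1 u + b * c1 v) (a * c2 u + b * c2 v)"

lemmas ivec_defs = dot_def cross_def lincomb_def

text \<open>
  The vectors \<open>w, z, y\<close> form a basis of the integer lattice; \<open>P\<close> is the primitive normal vector of
  the plane spanned by \<open>w\<close> and \<open>z\<close>.
\<close>

definition flag :: "ivec \<Rightarrow> ivec \<Rightarrow> bool" where
  "flag w P \<longleftrightarrow> (\<exists>z y. dot (cross w z) y = 1 \<and> P = cross w z)"

text \<open>\<open>dot m P = 0\<close> puts \<open>m\<close> in the plane of \<open>w\<close> and
  \<open>z\<close>, so \<open>cross m w\<close> is an integer multiple of \<open>P\<close>; the
  determinant is its coordinate \<open>c0\<close>.\<close>

lemma flag_dvd:
  assumes "flag w P" and "dot m P = 0"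
  shows "c0 P dvd c1 m * c2 w - c2 m * c1 w"
proof -
  obtain z y where d: "dot (cross w z) y = 1" and P: "P = cross w z"
    using assms(1) by (auto simp: flag_def)
  have "c1 m * c2 w - c2 m * c1 w = c0 P * - dot m (cross y w)"
    using d assms(2) unfolding P by (simp add: ivec_defs) algebra
  then show ?thesis by (rule dvdI)
qed

lemma ex_residue_in_window:
  fixes a q X :: int
  assumes "q > 0"
  shows "\<exists>t. X \<le> a + t * q \<and> a + t * q < X + q"
proof (intro exI conjI)
  have eq: "a + - ((a - X) div q) * q = X + (a - X) mod q"
    by (simp add: minus_div_mult_eq_mod [symmetric])
  show "X \<le> a + - ((a - X) div q) * q" "a + - ((a - X) div q) * q < X + q"
    unfolding eq using assms by simp_all
qed

text \<open>The plane is turned about \<open>w\<close>: with \<open>t z + y\<close> in place of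
  \<open>z\<close> the normal becomes \<open>t P + cross w y\<close>, so its \<open>c0\<close> can
  be any member of a residue class modulo \<open>c0 P\<close>. The cross product of the two normals
  is \<open>w\<close> times the determinant of the basis, which is 1.\<close>

lemma flag_rotate:
  assumes "flag w P" and "0 < c0 P" and "c0 P \<le> X"
  obtains P' where "flag w P'" "X \<le> c0 P'" "c0 P' \<le> 2 * X" "cross P P' = w"
proof -
  obtain z y where d: "dot (cross w z) y = 1" and P: "P = cross w z"
    using assms(1) by (auto simp: flag_def)
  obtain t where t: "X \<le> c0 (cross w y) + t * c0 P" "c0 (cross w y) + t * c0 P < X + c0 P"
    using ex_residue_in_window[OF assms(2)] by blast
  define P' where "P' = cross w (lincomb t z 1 y)"
  have q': "c0 P' = c0 (cross w y) + t * c0 P"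
    by (simp add: P'_def P ivec_defs algebra_simps)
  \<comment> \<open>\<open>lincomb (- 1) z 0 z\<close> is \<open>- z\<close>, which completes
    \<open>w\<close> and \<open>t z + y\<close> to a basis.\<close>
  have "dot P' (lincomb (- 1) z 0 z) = 1"
    using d unfolding P'_def by (simp add: ivec_defs) algebra
  then have "flag w P'"
    unfolding flag_def P'_def by blast
  moreover have "cross P P' = w"
  proof (rule ivec.expand, intro conjI)
    show "c0 (cross P P') = c0 w" "c1 (cross P P') = c1 w" "c2 (cross P P') = c2 w"
      using d unfolding P'_def P by (simp_all add: ivec_defs) algebra+
  qed
  ultimately show thesis
    using that t assms(3) by (simp add: q')
qed

text \<open>The plane stays and \<open>w\<close> moves inside it to \<open>e z + s w\<close>. The
  determinant is \<open>c0 (cross w w')\<close>, where \<open>s w\<close> drops out: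
  \<open>s\<close> is free to place \<open>c2 w'\<close>, and the sign \<open>e\<close> decides
  which way the slope moves.\<close>

lemma flag_switch:
  assumes "flag w P" and "0 < c2 w" and "e * e = 1"
  obtains w' where "flag w' P" "Y \<le> c2 w'" "c2 w' < Y + c2 w"
    "c1 w * c2 w' - c2 w * c1 w' = e * c0 P"
proof -
  obtain z y where d: "dot (cross w z) y = 1" and P: "P = cross w z"
    using assms(1) by (auto simp: flag_def)
  obtain s where s: "Y \<le> e * c2 z + s * c2 w" "e * c2 z + s * c2 w < Y + c2 w"
    using ex_residue_in_window[OF assms(2)] by blast
  define w' where "w' = lincomb e z s w"
  have P': "P = cross w' (lincomb (- e) w 0 w)"
    unfolding P w'_def
  proof (rule ivec.expand, intro conjI)
  qed (use assms(3) in \<open>simp_all add: ivec_defs\<close>, algebra+)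
  then have "flag w' P"
    using d P unfolding flag_def by metis
  moreover have "c1 w * c2 w' - c2 w * c1 w' = e * c0 P"
    by (simp add: P w'_def ivec_defs algebra_simps)
  ultimately show thesis
    using that s by (simp add: w'_def lincomb_def)
qed

section \<open>Growth of the sequence of points\<close>

definition sized :: "int \<Rightarrow> ivec \<Rightarrow> bool" where
  "sized X w \<longleftrightarrow> 4 * X \<le> c2 w \<and> c2 w \<le> 8 * X \<and> c2 w \<le> - 2 * c1 w \<and> - c1 w \<le> 2 * c2 w"

lemma sized_switch:
  assumes "flag w P" and "sized X w" and "1 \<le> X" and "2 * X \<le> Y"
    and "0 < c0 P" and "c0 P \<le> 2 * (X * Y)"
  obtains w' where "flag w' P" "sized Y w'" "c1 w * c2 w' \<noteq> c2 w * c1 w'"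
proof -
  \<comment> \<open>The switch moves the slope \<open>- c1 w / c2 w\<close> by at most \<open>1/8\<close>; \<open>e\<close> directs the move towards \<open>1\<close>.\<close>
  define e :: int where "e = (if - c1 w \<le> c2 w then 1 else - 1)"
  have w: "4 * X \<le> c2 w" "c2 w \<le> 8 * X" "c2 w \<le> - 2 * c1 w" "- c1 w \<le> 2 * c2 w"
    using assms(2) by (auto simp: sized_def)
  have w_pos: "0 < c2 w" using w assms(3) by linarith
  have "e * e = 1" by (simp add: e_def)
  from flag_switch[OF assms(1) w_pos this, where Y = "4 * Y"]
  obtain w' where w': "flag w' P" "4 * Y \<le> c2 w'" "c2 w' < 4 * Y + c2 w"
    and det: "c1 w * c2 w' - c2 w * c1 w' = e * c0 P" by blast
  have c2_pos: "0 < c2 w'" using w' assms by linarith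
  have "(4 * X) * (4 * Y) \<le> c2 w * c2 w'"
    by (rule mult_mono) (use w w' assms in linarith)+
  then have q: "8 * c0 P \<le> c2 w * c2 w'"
    using assms(6) by linarith
  have a: "c2 w * c2 w' \<le> 2 * (- c1 w * c2 w')"
    using mult_right_mono[OF w(3), of "c2 w'"] c2_pos by simp
  have b: "- c1 w * c2 w' \<le> 2 * (c2 w * c2 w')"
    using mult_right_mono[OF w(4), of "c2 w'"] c2_pos by simp
  have "c2 w * c2 w' \<le> c2 w * (- 2 * c1 w') \<and> c2 w * - c1 w' \<le> c2 w * (2 * c2 w')"
  proof (cases "- c1 w \<le> c2 w")
    case True
    then have "- c1 w * c2 w' \<le> c2 w * c2 w'"
      using c2_pos by (intro mult_right_mono) auto
    then show ?thesis using True a b q det assms(5) by (simp add: e_def)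
  next
    case False
    then have "c2 w * c2 w' \<le> - c1 w * c2 w'"
      using c2_pos by (intro mult_right_mono) auto
    then show ?thesis using False a b q det assms(5) by (simp add: e_def)
  qed
  then have "c2 w' \<le> - 2 * c1 w'" "- c1 w' \<le> 2 * c2 w'"
    using w_pos mult_le_cancel_left_pos by blast+
  \<comment> \<open>The upper bound on \<open>c2 w'\<close> holds since
    \<open>c2 w <= 8 * X <= 4 * Y\<close>.\<close>
  then have "sized Y w'"
    using w' w assms(4) by (simp add: sized_def)
  moreover have "c1 w * c2 w' \<noteq> c2 w * c1 w'"
    using det assms(5) by (auto simp: e_def split: if_splits)
  ultimately show thesis using that w'(1) by blast
qed

text \<open>Squaring \<open>T\<close> doubles the exponents 5 and 15 to 10 and 30, the sizes reached
  at the end of a \<open>link\<close>.\<close>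

definition state :: "int \<Rightarrow> ivec \<Rightarrow> ivec \<Rightarrow> bool" where
  "state T w P \<longleftrightarrow> flag w P \<and> sized (T ^ 5) w \<and> T ^ 15 \<le> c0 P \<and> c0 P \<le> 2 * T ^ 15"

definition link :: "int \<Rightarrow> ivec \<Rightarrow> ivec \<Rightarrow> ivec \<Rightarrow> ivec \<Rightarrow> ivec \<Rightarrow> bool" where
  "link T w' P P1 P2 P' \<longleftrightarrow> sized (T ^ 10) w' \<and> flag w' P1 \<and> flag w' P2 \<and>
     cross P P1 = w' \<and> cross P1 P2 = w' \<and> cross P2 P' = w' \<and>
     T ^ 24 \<le> c0 P1 \<and> c0 P1 \<le> 2 * T ^ 24 \<and> T ^ 26 \<le> c0 P2 \<and> c0 P2 \<le> 2 * T ^ 26 \<and>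
     T ^ 30 \<le> c0 P' \<and> c0 P' \<le> 2 * T ^ 30"

lemma two_power_le:
  fixes T :: int
  assumes "2 \<le> T" and "a < b"
  shows "2 * T ^ a \<le> T ^ b"
proof -
  have "2 * T ^ a \<le> T * T ^ a" using assms by (intro mult_right_mono) auto
  also have "\<dots> = T ^ Suc a" by simp
  also have "\<dots> \<le> T ^ b" using assms by (intro power_increasing) auto
  finally show ?thesis .
qed

text \<open>A switch at \<open>P\<close>, then three rotations about the new \<open>w'\<close>. The
  switch fits because \<open>c0 P\<close> is of order \<open>T ^ 15 = T ^ 5 * T ^ 10\<close>, the
  product of the old and new sizes.\<close>

lemma state_step:
  assumes "state T w P" and "2 \<le> T"
  obtains w' P1 P2 P' where "state (T\<^sup>2) w' P'" "link T w' P P1 P2 P'"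
    "c1 w * c2 w' \<noteq> c2 w * c1 w'"
proof -
  have st: "flag w P" "sized (T ^ 5) w" "T ^ 15 \<le> c0 P" "c0 P \<le> 2 * T ^ 15"
    using assms(1) by (auto simp: state_def)
  have pos: "0 < T ^ k" for k using assms(2) by simp
  have q: "0 < c0 P" using st(3) pos[of 15] by linarith
  have "c0 P \<le> 2 * (T ^ 5 * T ^ 10)" using st(4) by (simp flip: power_add)
  moreover have "1 \<le> T ^ 5" using pos[of 5] by linarith
  ultimately obtain w' where w': "flag w' P" "sized (T ^ 10) w'" "c1 w * c2 w' \<noteq> c2 w * c1 w'"
    using sized_switch[OF st(1,2) _ two_power_le[OF assms(2), of 5 10] q] by auto
  have "c0 P \<le> T ^ 24" using st(4) two_power_le[OF assms(2), of 15 24] by linarith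
  from flag_rotate[OF w'(1) q this] obtain P1 where
    P1: "flag w' P1" "T ^ 24 \<le> c0 P1" "c0 P1 \<le> 2 * T ^ 24" "cross P P1 = w'" .
  have q1: "0 < c0 P1" using P1(2) pos[of 24] by linarith
  have "c0 P1 \<le> T ^ 26" using P1(3) two_power_le[OF assms(2), of 24 26] by linarith
  from flag_rotate[OF P1(1) q1 this] obtain P2 where
    P2: "flag w' P2" "T ^ 26 \<le> c0 P2" "c0 P2 \<le> 2 * T ^ 26" "cross P1 P2 = w'" .
  have q2: "0 < c0 P2" using P2(2) pos[of 26] by linarith
  have "c0 P2 \<le> T ^ 30" using P2(3) two_power_le[OF assms(2), of 26 30] by linarith
  from flag_rotate[OF P2(1) q2 this] obtain P3 where
    P3: "flag w' P3" "T ^ 30 \<le> c0 P3" "c0 P3 \<le> 2 * T ^ 30" "cross P2 P3 = w'" .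
  have "state (T\<^sup>2) w' P3"
    using w' P3 by (simp add: state_def flip: power_mult)
  moreover have "link T w' P P1 P2 P3"
    using w' P1 P2 P3 by (simp add: link_def)
  ultimately show thesis using that w'(3) by blast
qed

lemma ex_state:
  assumes "2 \<le> (T :: int)"
  shows "\<exists>w P. state T w P"
proof -
  define A where "A = 4 * T ^ 5"
  \<comment> \<open>The consecutive entries \<open>A\<close> and \<open>A + 1\<close> give slope
    close to 1 and determinant \<open>(A + 1) - A = 1\<close> with \<open>y\<close>;
    \<open>z\<close> is chosen to make \<open>c0 (cross w z) = T ^ 15\<close>.\<close>
  define w z y where "w = IVec 0 (- A) (A + 1)" and "z = IVec 1 (- (T ^ 15)) (T ^ 15)"
    and "y = IVec 0 1 (- 1)"
  have "dot (cross w z) y = 1"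
    by (simp add: w_def z_def y_def ivec_defs algebra_simps)
  then have "flag w (cross w z)" by (auto simp: flag_def)
  moreover have "c0 (cross w z) = T ^ 15"
    by (simp add: w_def z_def ivec_defs algebra_simps)
  moreover have "1 \<le> T ^ 5" using assms by simp
  then have "sized (T ^ 5) w"
    by (simp add: sized_def w_def A_def)
  ultimately have "state T w (cross w z)"
    using assms by (simp add: state_def)
  then show ?thesis by blast
qed

text \<open>Each term is the square of the one before, as \<open>state_step\<close> requires. The
  base absorbs constants, such as \<open>4 * 32 * 2 = 256\<close> in
  \<open>linear_form_lower_bound\<close>.\<close>

definition scale :: "nat \<Rightarrow> int" where
  "scale n = 256 ^ (2 ^ n)"

lemma scale_Suc: "scale (Suc n) = (scale n)\<^sup>2"
  by (simp add: scale_def mult.commute flip: power_mult)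

lemma scale_ge: "256 \<le> scale n"
  unfolding scale_def using self_le_power[of "256 :: int" "2 ^ n"] by simp

lemma ex_state_sequence:
  obtains w P P1 P2 where "\<And>n. state (scale n) (w n) (P n)"
    "\<And>n. link (scale n) (w (Suc n)) (P n) (P1 n) (P2 n) (P (Suc n))"
    "\<And>n. c1 (w n) * c2 (w (Suc n)) \<noteq> c2 (w n) * c1 (w (Suc n))"
proof -
  have "\<exists>f. \<forall>n. state (scale n) (fst (f n)) (snd (f n)) \<and>
     ((\<exists>P1 P2. link (scale n) (fst (f (Suc n))) (snd (f n)) P1 P2 (snd (f (Suc n)))) \<and>
     c1 (fst (f n)) * c2 (fst (f (Suc n))) \<noteq> c2 (fst (f n)) * c1 (fst (f (Suc n))))"
  proof (rule dependent_nat_choice)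
    show "\<exists>x. state (scale 0) (fst x) (snd x)"
      using ex_state[of "scale 0"] by (simp add: scale_def)
  next
    fix x n assume st: "state (scale n) (fst x) (snd x)"
    have "2 \<le> scale n" using scale_ge[of n] by simp
    from state_step[OF st this] show "\<exists>y. state (scale (Suc n)) (fst y) (snd y) \<and>
       ((\<exists>P1 P2. link (scale n) (fst y) (snd x) P1 P2 (snd y)) \<and>
        c1 (fst x) * c2 (fst y) \<noteq> c2 (fst x) * c1 (fst y))"
      unfolding scale_Suc by (metis fst_conv snd_conv)
  qed
  then obtain f where f: "\<And>n. state (scale n) (fst (f n)) (snd (f n))"
     "\<And>n. \<exists>P1 P2. link (scale n) (fst (f (Suc n))) (snd (f n)) P1 P2 (snd (f (Suc n)))"
     "\<And>n. c1 (fst (f n)) * c2 (fst (f (Suc n))) \<noteq> c2 (fst (f n)) * c1 (fst (f (Suc n)))"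
    by blast
  from f(2) obtain P1 P2 where
    "\<And>n. link (scale n) (fst (f (Suc n))) (snd (f n)) (P1 n) (P2 n) (snd (f (Suc n)))"
    by metis
  with f show thesis using that[of "\<lambda>n. fst (f n)" "\<lambda>n. snd (f n)" P1 P2] by blast
qed

section \<open>Convergence of the rational points\<close>

definition ratio :: "(ivec \<Rightarrow> int) \<Rightarrow> ivec \<Rightarrow> real" where
  "ratio f P = of_int (f P) / of_int (c0 P)"

text \<open>The difference is \<open>c2 w\<close> or \<open>- c1 w\<close> divided by
  \<open>c0 P * c0 P'\<close>. Both numerators lie between \<open>2 * X\<close> and
  \<open>16 * X\<close>, the denominator between \<open>Y * Z\<close> and
  \<open>4 * Y * Z\<close>.\<close>

lemma ratio_step:
  assumes "cross P P' = w" and "sized X w" and "0 < Y" and "0 < Z"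
    and "Y \<le> c0 P" and "c0 P \<le> 2 * Y" and "Z \<le> c0 P'" and "c0 P' \<le> 2 * Z"
    and f: "f = c1 \<or> f = c2"
  shows "of_int X / (2 * (of_int Y * of_int Z)) \<le> ratio f P' - ratio f P"
    and "ratio f P' - ratio f P \<le> 16 * of_int X / (of_int Y * of_int Z)"
proof -
  have q: "0 < c0 P" "0 < c0 P'" using assms by linarith+
  define x where "x = (if f = c1 then c2 w else - c1 w)"
  have x: "2 * X \<le> x" "x \<le> 16 * X" "0 \<le> X"
    using assms(2) by (auto simp: x_def sized_def)
  have w: "c2 w = c0 P * c1 P' - c1 P * c0 P'" "- c1 w = c0 P * c2 P' - c2 P * c0 P'"
    unfolding assms(1)[symmetric] by (simp_all add: cross_def)
  have "x = c0 P * f P' - f P * c0 P'"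
    using f w by (auto simp: x_def)
  then have x': "real_of_int x = of_int (c0 P) * of_int (f P') - of_int (f P) * of_int (c0 P')"
    by simp
  have eq: "ratio f P' - ratio f P = of_int x / (of_int (c0 P) * of_int (c0 P'))"
    unfolding x' using q by (simp add: ratio_def field_simps)
  have "c0 P * c0 P' \<le> (2 * Y) * (2 * Z)"
    by (rule mult_mono) (use assms q in linarith)+
  moreover have "Y * Z \<le> c0 P * c0 P'"
    by (rule mult_mono) (use assms q in linarith)+
  ultimately have "real_of_int (c0 P * c0 P') \<le> of_int ((2 * Y) * (2 * Z))"
    "real_of_int (Y * Z) \<le> of_int (c0 P * c0 P')"
    by (simp_all only: of_int_le_iff)
  then have d: "real_of_int (c0 P) * of_int (c0 P') \<le> 4 * (of_int Y * of_int Z)"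
    "real_of_int Y * of_int Z \<le> of_int (c0 P) * of_int (c0 P')"
    by simp_all
  have xr: "2 * real_of_int X \<le> of_int x" "real_of_int x \<le> 16 * of_int X" "0 \<le> real_of_int x"
    using x by linarith+
  have "of_int X / (2 * (of_int Y * of_int Z)) = (2 * real_of_int X) / (4 * (of_int Y * of_int Z))"
    by simp
  also have "\<dots> \<le> of_int x / (of_int (c0 P) * of_int (c0 P'))"
    using xr d q by (intro frac_le) auto
  finally show "of_int X / (2 * (of_int Y * of_int Z)) \<le> ratio f P' - ratio f P"
    unfolding eq .
  have "of_int x / (of_int (c0 P) * of_int (c0 P')) \<le> 16 * real_of_int X / (of_int Y * of_int Z)"
    using xr d q x(3) assms(3,4) by (intro frac_le) auto
  then show "ratio f P' - ratio f P \<le> 16 * of_int X / (of_int Y * of_int Z)"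
    unfolding eq .
qed

text \<open>The exponents are \<open>15 + 24 - 10\<close>, \<open>24 + 26 - 10\<close> and
  \<open>26 + 30 - 10\<close>.\<close>

lemma link_ratio:
  fixes T :: int
  assumes "link T w' P P1 P2 P'" and "state T w P" and "256 \<le> T" and f: "f = c1 \<or> f = c2"
  defines "t \<equiv> 1 / real_of_int T"
  shows "t ^ 29 / 2 \<le> ratio f P1 - ratio f P" "ratio f P1 - ratio f P \<le> 16 * t ^ 29"
    "t ^ 40 / 2 \<le> ratio f P2 - ratio f P1" "ratio f P2 - ratio f P1 \<le> 16 * t ^ 40"
    "t ^ 46 / 2 \<le> ratio f P' - ratio f P2" "ratio f P' - ratio f P2 \<le> 16 * t ^ 46"
proof -
  have pos: "0 < T ^ k" for k using assms(3) by simp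
  note rs = ratio_step[OF _ _ pos pos _ _ _ _ f]
  have l: "sized (T ^ 10) w'" "cross P P1 = w'" "cross P1 P2 = w'" "cross P2 P' = w'"
    "T ^ 24 \<le> c0 P1" "c0 P1 \<le> 2 * T ^ 24" "T ^ 26 \<le> c0 P2" "c0 P2 \<le> 2 * T ^ 26"
    "T ^ 30 \<le> c0 P'" "c0 P' \<le> 2 * T ^ 30" "T ^ 15 \<le> c0 P" "c0 P \<le> 2 * T ^ 15"
    using assms(1,2) by (auto simp: link_def state_def)
  have eq: "real_of_int (T ^ 10) / (2 * (of_int (T ^ i) * of_int (T ^ j))) = t ^ k / 2"
    "16 * real_of_int (T ^ 10) / (of_int (T ^ i) * of_int (T ^ j)) = 16 * t ^ k"
    if "i + j = k + 10" for i j k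
  proof -
    have "real_of_int T ^ i * of_int T ^ j = of_int T ^ k * of_int T ^ 10"
      using that by (metis power_add)
    then show "real_of_int (T ^ 10) / (2 * (of_int (T ^ i) * of_int (T ^ j))) = t ^ k / 2"
      "16 * real_of_int (T ^ 10) / (of_int (T ^ i) * of_int (T ^ j)) = 16 * t ^ k"
      using assms(3) by (simp_all add: t_def power_one_over divide_simps)
  qed
  show "t ^ 29 / 2 \<le> ratio f P1 - ratio f P" "ratio f P1 - ratio f P \<le> 16 * t ^ 29"
    using rs[OF l(2,1,11,12,5,6)] by (simp_all only: eq[of 15 24 29])
  show "t ^ 40 / 2 \<le> ratio f P2 - ratio f P1" "ratio f P2 - ratio f P1 \<le> 16 * t ^ 40"
    using rs[OF l(3,1,5,6,7,8)] by (simp_all only: eq[of 24 26 40])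
  show "t ^ 46 / 2 \<le> ratio f P' - ratio f P2" "ratio f P' - ratio f P2 \<le> 16 * t ^ 46"
    using rs[OF l(4,1,7,8,9,10)] by (simp_all only: eq[of 26 30 46])
qed

lemma power_drop:
  fixes t :: real
  assumes "0 < t" and "t \<le> 1 / 256" and "a < b"
  shows "256 * t ^ b \<le> t ^ a"
proof -
  have "t ^ b \<le> t ^ Suc a" using assms by (intro power_decreasing) auto
  also have "\<dots> \<le> (1 / 256) * t ^ a" unfolding power_Suc using assms by (intro mult_right_mono) auto
  finally show ?thesis by simp
qed

lemma nested_intervals:
  fixes a b :: "nat \<Rightarrow> real"
  assumes "\<And>n. a n \<le> a (Suc n)" and "\<And>n. b (Suc n) \<le> b n" and "\<And>n. a n \<le> b n"
  obtains x where "\<And>n. a n \<le> x" "\<And>n. x \<le> b n"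
proof -
  have "incseq a" "decseq b" using assms by (auto intro: incseq_SucI decseq_SucI)
  have "a n \<le> b m" for n m
  proof -
    have "a n \<le> a (max n m)" "b (max n m) \<le> b m"
      using \<open>incseq a\<close> \<open>decseq b\<close> by (auto simp: incseq_def decseq_def)
    then show ?thesis using assms(3)[of "max n m"] by linarith
  qed
  then have "a n \<le> (SUP n. a n)" "(SUP n. a n) \<le> b n" for n
    by (auto intro!: cSUP_upper cSUP_least bdd_aboveI2)
  then show thesis using that by blast
qed

lemma ex_limit:
  assumes st: "\<And>n. state (scale n) (w n) (P n)"
    and li: "\<And>n. link (scale n) (w (Suc n)) (P n) (P1 n) (P2 n) (P (Suc n))"
    and f: "f = c1 \<or> f = c2"
  obtains x where
    "\<And>n. x - ratio f (P n) \<in> {(1 / scale n) ^ 29 / 2 .. 32 * (1 / scale n) ^ 29}"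
    "\<And>n. x - ratio f (P1 n) \<in> {(1 / scale n) ^ 40 / 2 .. 32 * (1 / scale n) ^ 40}"
    "\<And>n. x - ratio f (P2 n) \<in> {(1 / scale n) ^ 46 / 2 .. 32 * (1 / scale n) ^ 46}"
proof -
  define t where "t n = 1 / real_of_int (scale n)" for n
  have t: "0 < t n" "t n \<le> 1 / 256" for n
    using scale_ge[of n] by (auto simp: t_def divide_simps)
  have tS: "t (Suc n) ^ 29 = t n ^ 58" for n
    by (simp add: t_def scale_Suc power_one_over flip: power_mult)
  note r = link_ratio[OF li st scale_ge f, folded t_def]
  have d: "256 * t n ^ 40 \<le> t n ^ 29" "256 * t n ^ 46 \<le> t n ^ 40" "256 * t n ^ 58 \<le> t n ^ 46" for n
    by (rule power_drop[OF t], simp)+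
  \<comment> \<open>The step out of a point is at most 16 times its power of \<open>t\<close>;
    doubling 16 to 32 covers all later steps, which are smaller by factors of 256. The first line
    makes the intervals at the \<open>P n\<close> nested; the others transfer the bounds to
    \<open>P1\<close> and \<open>P2\<close>.\<close>
  have up: "ratio f (P (Suc n)) + 32 * t (Suc n) ^ 29 \<le> ratio f (P n) + 32 * t n ^ 29"
    "ratio f (P (Suc n)) + 32 * t (Suc n) ^ 29 \<le> ratio f (P1 n) + 32 * t n ^ 40"
    "ratio f (P (Suc n)) + 32 * t (Suc n) ^ 29 \<le> ratio f (P2 n) + 32 * t n ^ 46" for n
    using r[of n] d[of n] zero_less_power[OF t(1), of n 29] zero_less_power[OF t(1), of n 40]
      zero_less_power[OF t(1), of n 46] unfolding tS
    by linarith+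
  have low: "ratio f (P n) + t n ^ 29 / 2 \<le> ratio f (P (Suc n))"
    "ratio f (P1 n) + t n ^ 40 / 2 \<le> ratio f (P (Suc n))"
    "ratio f (P2 n) + t n ^ 46 / 2 \<le> ratio f (P (Suc n))" for n
    using r[of n] zero_less_power[OF t(1), of n 29] zero_less_power[OF t(1), of n 40]
      zero_less_power[OF t(1), of n 46]
    by linarith+
  obtain x where x: "\<And>n. ratio f (P n) \<le> x" "\<And>n. x \<le> ratio f (P n) + 32 * t n ^ 29"
  proof (rule nested_intervals)
    show "ratio f (P n) \<le> ratio f (P (Suc n))" for n
      using low(1)[of n] zero_less_power[OF t(1), of n 29] by linarith
    show "ratio f (P (Suc n)) + 32 * t (Suc n) ^ 29 \<le> ratio f (P n) + 32 * t n ^ 29" for n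
      by (rule up)
    show "ratio f (P n) \<le> ratio f (P n) + 32 * t n ^ 29" for n
      using t(1)[of n] by simp
  qed blast
  show thesis
  proof (rule that)
    fix n
    show "x - ratio f (P n) \<in> {(1 / scale n) ^ 29 / 2 .. 32 * (1 / scale n) ^ 29}"
      "x - ratio f (P1 n) \<in> {(1 / scale n) ^ 40 / 2 .. 32 * (1 / scale n) ^ 40}"
      "x - ratio f (P2 n) \<in> {(1 / scale n) ^ 46 / 2 .. 32 * (1 / scale n) ^ 46}"
      using up[of n] low[of n] x[of "Suc n"] unfolding t_def atLeastAtMost_iff by linarith+
  qed
qed

section \<open>Size and vanishing of linear forms\<close>

lemma linear_form_eq:
  assumes "0 < c0 P"
  shows "of_int (c0 m) + of_int (c1 m) * \<alpha>\<^sub>1 + of_int (c2 m) * \<alpha>\<^sub>2 =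
    of_int (dot m P) / of_int (c0 P)
      + (of_int (c1 m) * (\<alpha>\<^sub>1 - ratio c1 P) + of_int (c2 m) * (\<alpha>\<^sub>2 - ratio c2 P))"
  using assms by (simp add: dot_def ratio_def field_simps)

text \<open>The value at the rational point is a multiple of \<open>1 / c0 P\<close>. As
  \<open>m\<close> has nonnegative coefficients, the error \<open>E\<close> lies between
  \<open>M * l\<close> and \<open>2 * M * u\<close>, which is at most half of
  \<open>1 / c0 P\<close>.\<close>

lemma linear_form_dichotomy:
  assumes "flag w P" and "sized X w" and "0 < X" and "0 < c0 P" and "0 \<le> c1 m" and "0 \<le> c2 m"
    and M: "M = max (c1 m) (c2 m)" and "0 < M"
    and l: "0 \<le> l" "\<alpha>\<^sub>1 - ratio c1 P \<in> {l..u}" "\<alpha>\<^sub>2 - ratio c2 P \<in> {l..u}"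
    and small: "4 * of_int M * u * of_int (c0 P) \<le> 1"
  defines "L \<equiv> \<bar>of_int (c0 m) + of_int (c1 m) * \<alpha>\<^sub>1 + of_int (c2 m) * \<alpha>\<^sub>2\<bar>"
  shows "1 / (2 * of_int (c0 P)) \<le> L \<or> of_int M * l \<le> L \<and> c0 P \<le> 24 * X * M"
proof -
  define E where "E = of_int (c1 m) * (\<alpha>\<^sub>1 - ratio c1 P) + of_int (c2 m) * (\<alpha>\<^sub>2 - ratio c2 P)"
  have L: "L = \<bar>of_int (dot m P) / of_int (c0 P) + E\<bar>"
    unfolding L_def E_def using linear_form_eq[OF assms(4)] by simp
  have m: "0 \<le> real_of_int (c1 m)" "0 \<le> real_of_int (c2 m)"
    "real_of_int (c1 m) \<le> of_int M" "real_of_int (c2 m) \<le> of_int M"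
    using assms by auto
  have lo: "of_int (c1 m) * l \<le> of_int (c1 m) * (\<alpha>\<^sub>1 - ratio c1 P)"
     "of_int (c2 m) * l \<le> of_int (c2 m) * (\<alpha>\<^sub>2 - ratio c2 P)"
     "0 \<le> of_int (c1 m) * l" "0 \<le> of_int (c2 m) * l"
    using l m by (auto intro!: mult_left_mono)
  have "of_int M * l = of_int (c1 m) * l \<or> of_int M * l = of_int (c2 m) * l"
    by (auto simp: M max_def)
  then have E1: "of_int M * l \<le> E"
    unfolding E_def using lo by linarith
  have E0: "0 \<le> E" unfolding E_def using lo by linarith
  have "of_int (c1 m) * (\<alpha>\<^sub>1 - ratio c1 P) \<le> of_int M * u"
     "of_int (c2 m) * (\<alpha>\<^sub>2 - ratio c2 P) \<le> of_int M * u"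
    using l m by (auto intro!: mult_mono)
  then have E2: "E \<le> 2 * (of_int M * u)" unfolding E_def by linarith
  have E_small: "E \<le> 1 / (2 * of_int (c0 P))"
  proof -
    have "2 * (of_int M * u) \<le> 1 / (2 * of_int (c0 P))"
      using small assms(4) by (simp add: field_simps)
    then show ?thesis using E2 by linarith
  qed
  show ?thesis
  proof (cases "dot m P = 0")
    case True
    \<comment> \<open>The signs \<open>c1 w < 0 < c2 w\<close> make this a sum of nonnegative terms,
      so divisibility by \<open>c0 P\<close> gives a lower bound for \<open>M\<close>.\<close>
    have D: "0 < c1 m * c2 w - c2 m * c1 w" "c1 m * c2 w - c2 m * c1 w \<le> M * (8 * X) + M * (16 * X)"
    proof -
      have w: "0 < c2 w" "0 < - c1 w" "c2 w \<le> 8 * X" "- c1 w \<le> 16 * X"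
        using assms(2,3) by (auto simp: sized_def)
      have "0 < c1 m \<or> 0 < c2 m" using assms(8) M by (auto simp: max_def split: if_splits)
      then have "0 < c1 m * c2 w + c2 m * - c1 w"
      proof
        assume "0 < c1 m"
        then show ?thesis using w(1,2) assms(6) by (intro add_pos_nonneg mult_pos_pos mult_nonneg_nonneg) auto
      next
        assume "0 < c2 m"
        then show ?thesis using w(1,2) assms(5) by (intro add_nonneg_pos mult_pos_pos mult_nonneg_nonneg) auto
      qed
      then show "0 < c1 m * c2 w - c2 m * c1 w" by simp
      have "c1 m * c2 w + c2 m * - c1 w \<le> M * (8 * X) + M * (16 * X)"
        using w assms(5-8) by (intro add_mono mult_mono) auto
      then show "c1 m * c2 w - c2 m * c1 w \<le> M * (8 * X) + M * (16 * X)" by simp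
    qed
    have "c0 P \<le> c1 m * c2 w - c2 m * c1 w"
      using flag_dvd[OF assms(1) True] D(1) by (rule zdvd_imp_le)
    then have "c0 P \<le> 24 * X * M" using D(2) by (simp add: algebra_simps)
    moreover have "of_int M * l \<le> L" using E1 E0 True L by simp
    ultimately show ?thesis by blast
  next
    case False
    have "1 \<le> \<bar>dot m P\<bar>"
      using False by linarith
    then have "1 \<le> \<bar>real_of_int (dot m P)\<bar>"
      by (metis of_int_1_le_iff of_int_abs)
    then have "1 / of_int (c0 P) \<le> \<bar>of_int (dot m P) / real_of_int (c0 P)\<bar>"
      using assms(4) by (simp add: abs_divide divide_right_mono)
    moreover have "1 / of_int (c0 P) = 2 * (1 / (2 * real_of_int (c0 P)))" by simp
    ultimately have "1 / (2 * of_int (c0 P)) \<le> L"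
      using E_small E0 unfolding L by linarith
    then show ?thesis ..
  qed
qed

lemma power_le_powr:
  fixes T x s :: real
  assumes "1 \<le> T" and "T ^ b \<le> x" and "real c \<le> s * real b" and "0 \<le> s"
  shows "T ^ c \<le> x powr s"
proof -
  have "T ^ c = T powr real c" using assms(1) by (simp add: powr_realpow)
  also have "\<dots> \<le> T powr (real b * s)" using assms by (intro powr_mono) (auto simp: mult.commute)
  also have "\<dots> = (T ^ b) powr s" using assms(1) by (simp add: powr_realpow flip: powr_powr)
  also have "\<dots> \<le> x powr s" using assms by (intro powr_mono2) auto
  finally show ?thesis .
qed

text \<open>The conditions on exponents: \<open>a + b' < c\<close> keeps the error below half of
  \<open>1 / c0 P\<close>; \<open>10 * a <= 19 * b\<close> bounds \<open>T ^ a\<close> by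
  \<open>M powr 1.9\<close> in the first alternative. In the second, \<open>24 * M >= T ^ k\<close>,
  and \<open>10 * c <= 29 * k\<close> bounds \<open>T ^ c\<close> by
  \<open>(24 * M) powr 2.9\<close>, one power of \<open>M\<close> being regained from the factor
  \<open>M\<close> in the error.\<close>

lemma linear_form_lower_bound:
  fixes T :: int
  assumes T: "256 \<le> T" and "flag w P" and "sized (T ^ d) w" and q: "T ^ a \<le> c0 P" "c0 P \<le> 2 * T ^ a"
    and "0 \<le> c1 m" and "0 \<le> c2 m" and M_def: "M = max (c1 m) (c2 m)"
    and M: "T ^ b \<le> M" "M < T ^ b'"
    and \<alpha>: "\<alpha>\<^sub>1 - ratio c1 P \<in> {(1 / T) ^ c / 2 .. 32 * (1 / T) ^ c}"
      "\<alpha>\<^sub>2 - ratio c2 P \<in> {(1 / T) ^ c / 2 .. 32 * (1 / T) ^ c}"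
    and e: "a + b' < c" "10 * a \<le> 19 * b" "d + k = a" "10 * c \<le> 29 * k"
  shows "1 / (2 ^ 16 * of_int M powr (19 / 10))
    \<le> \<bar>of_int (c0 m) + of_int (c1 m) * \<alpha>\<^sub>1 + of_int (c2 m) * \<alpha>\<^sub>2\<bar>" (is "_ \<le> ?L")
proof -
  define t where "t = real_of_int T"
  have t: "256 \<le> t" using T by (simp add: t_def)
  have pos: "0 < T ^ i" "0 < t ^ i" for i using T t by auto
  have M_pos: "0 < M" using M(1) pos(1)[of b] by linarith
  have q_pos: "0 < c0 P" using q(1) pos(1)[of a] by linarith
  have qr: "t ^ a \<le> of_int (c0 P)" "of_int (c0 P) \<le> 2 * t ^ a"
  proof -
    have "real_of_int (T ^ a) \<le> of_int (c0 P)" "real_of_int (c0 P) \<le> of_int (2 * T ^ a)"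
      using q by (simp_all only: of_int_le_iff)
    then show "t ^ a \<le> of_int (c0 P)" "of_int (c0 P) \<le> 2 * t ^ a"
      by (simp_all add: t_def)
  qed
  have Mr: "t ^ b \<le> of_int M" "of_int M \<le> t ^ b'"
    using M unfolding t_def by (simp_all flip: of_int_power)
  have "4 * of_int M * (32 * (1 / t) ^ c) * of_int (c0 P) \<le> 4 * t ^ b' * (32 * (1 / t) ^ c) * (2 * t ^ a)"
    using Mr qr pos M_pos q_pos t by (intro mult_mono) auto
  also have "\<dots> = 256 * t ^ (a + b') / t ^ c"
    by (simp add: power_one_over power_add)
  also have "\<dots> \<le> 1"
  proof -
    have "256 * t ^ (a + b') \<le> t ^ Suc (a + b')"
      using t by simp
    also have "\<dots> \<le> t ^ c" using e t by (intro power_increasing) auto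
    finally show ?thesis using pos(2)[of c] by simp
  qed
  finally have small: "4 * of_int M * (32 * (1 / t) ^ c) * of_int (c0 P) \<le> 1" .
  have "1 / (2 * of_int (c0 P)) \<le> ?L \<or> of_int M * ((1 / t) ^ c / 2) \<le> ?L \<and> c0 P \<le> 24 * T ^ d * M"
    by (rule linear_form_dichotomy[OF assms(2,3) pos(1) q_pos assms(6,7) M_def M_pos _
          \<alpha>[folded t_def] small]) (use t in simp)
  then show ?thesis
  proof
    assume L: "1 / (2 * of_int (c0 P)) \<le> ?L"
    have "t ^ a \<le> of_int M powr (19 / 10)"
      using t Mr e by (intro power_le_powr[where b = b]) auto
    then have "2 * real_of_int (c0 P) \<le> 2 ^ 16 * of_int M powr (19 / 10)"
      using qr pos(2)[of a] by simp
    then have "1 / (2 ^ 16 * real_of_int M powr (19 / 10)) \<le> 1 / (2 * of_int (c0 P))"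
      using q_pos M_pos by (intro divide_left_mono) auto
    then show ?thesis using L by linarith
  next
    assume L: "of_int M * ((1 / t) ^ c / 2) \<le> ?L \<and> c0 P \<le> 24 * T ^ d * M"
    then have "of_int (c0 P) \<le> real_of_int (24 * T ^ d * M)"
      by (simp only: of_int_le_iff)
    then have "of_int (c0 P) \<le> t ^ d * (24 * of_int M)"
      by (simp add: t_def mult_ac)
    moreover have "t ^ d * t ^ k = t ^ a"
      using e(3) by (simp flip: power_add)
    ultimately have "t ^ d * t ^ k \<le> t ^ d * (24 * of_int M)"
      using qr(1) by linarith
    then have "t ^ k \<le> 24 * of_int M"
      using pos(2)[of d] by simp
    then have "t ^ c \<le> (24 * of_int M) powr (29 / 10)"
      using t e by (intro power_le_powr[where b = k]) auto
    also have "\<dots> = 24 powr (29 / 10) * of_int M powr (29 / 10)"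
      using M_pos by (simp add: powr_mult)
    \<comment> \<open>The bound goes through \<open>24 powr 3\<close>; \<open>2 ^ 15\<close> and the
      factor \<open>1 / 2\<close> of the error bound yield \<open>2 ^ 16\<close>.\<close>
    also have "(24 :: real) powr (29 / 10) \<le> 32 powr 3"
      by (rule order_trans[OF powr_mono powr_mono2]) auto
    also have "(32 :: real) powr 3 = 2 ^ 15" by simp
    also have "real_of_int M powr (29 / 10) = of_int M * of_int M powr (19 / 10)"
      using M_pos by (simp add: powr_mult_base)
    finally have tc: "t ^ c \<le> 2 ^ 15 * (of_int M * of_int M powr (19 / 10))"
      by (simp add: mult_right_mono)
    have "1 / (2 ^ 16 * real_of_int M powr (19 / 10))
      = of_int M / (2 * (2 ^ 15 * (of_int M * of_int M powr (19 / 10))))"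
      using M_pos by simp
    also have "\<dots> \<le> of_int M / (2 * t ^ c)"
      using tc pos(2)[of c] M_pos by (intro divide_left_mono) auto
    also have "\<dots> = of_int M * ((1 / t) ^ c / 2)"
      by (simp add: power_one_over)
    finally show ?thesis using L by linarith
  qed
qed

text \<open>The integer \<open>dot m P\<close> equals \<open>c0 P\<close> times an error, up to
  sign, so it is at most \<open>64 / T ^ 13 < 1\<close> in size and vanishes. Then
  \<open>c0 P >= T ^ 15\<close> divides a determinant of size at most \<open>T ^ 7\<close>. The
  signs in \<open>m\<close> are arbitrary here.\<close>

lemma vanishing_form_parallel:
  fixes T :: int
  assumes T: "256 \<le> T" and st: "state T w P" and N: "\<bar>c1 m\<bar> + \<bar>c2 m\<bar> < T"
    and \<alpha>: "\<alpha>\<^sub>1 - ratio c1 P \<in> {0 .. 32 * (1 / T) ^ 29}"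
      "\<alpha>\<^sub>2 - ratio c2 P \<in> {0 .. 32 * (1 / T) ^ 29}"
    and L: "of_int (c0 m) + of_int (c1 m) * \<alpha>\<^sub>1 + of_int (c2 m) * \<alpha>\<^sub>2 = 0"
  shows "c1 m * c2 w = c2 m * c1 w"
proof -
  define t where "t = real_of_int T"
  have t: "256 \<le> t" using T by (simp add: t_def)
  have fl: "flag w P" and sz: "sized (T ^ 5) w" and q: "T ^ 15 \<le> c0 P" "c0 P \<le> 2 * T ^ 15"
    using st by (auto simp: state_def)
  have q_pos: "0 < c0 P" using q(1) T zero_less_power[of T 15] by linarith
  define E where "E = of_int (c1 m) * (\<alpha>\<^sub>1 - ratio c1 P) + of_int (c2 m) * (\<alpha>\<^sub>2 - ratio c2 P)"
  have "of_int (dot m P) / of_int (c0 P) + E = 0"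
    using L linear_form_eq[OF q_pos] unfolding E_def by metis
  then have "real_of_int (dot m P) = - (of_int (c0 P) * E)"
    using q_pos by (simp add: field_simps)
  then have k: "\<bar>real_of_int (dot m P)\<bar> = of_int (c0 P) * \<bar>E\<bar>"
    using q_pos by (simp add: abs_mult)
  have "\<bar>E\<bar> \<le> \<bar>of_int (c1 m)\<bar> * \<bar>\<alpha>\<^sub>1 - ratio c1 P\<bar> + \<bar>of_int (c2 m)\<bar> * \<bar>\<alpha>\<^sub>2 - ratio c2 P\<bar>"
    unfolding E_def by (metis abs_mult abs_triangle_ineq)
  also have "\<dots> \<le> \<bar>of_int (c1 m)\<bar> * (32 * (1 / t) ^ 29) + \<bar>of_int (c2 m)\<bar> * (32 * (1 / t) ^ 29)"
    using \<alpha> unfolding t_def by (intro add_mono mult_left_mono) auto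
  also have "\<dots> = (\<bar>of_int (c1 m)\<bar> + \<bar>of_int (c2 m)\<bar>) * (32 * (1 / t) ^ 29)"
    by (simp add: distrib_right)
  also have "\<dots> \<le> t * (32 * (1 / t) ^ 29)"
    using N t unfolding t_def by (intro mult_right_mono) (auto simp flip: of_int_abs of_int_add)
  finally have E: "\<bar>E\<bar> \<le> t * (32 * (1 / t) ^ 29)" .
  have "real_of_int (c0 P) \<le> of_int (2 * T ^ 15)" using q(2) by (simp only: of_int_le_iff)
  then have "of_int (c0 P) * \<bar>E\<bar> \<le> (2 * t ^ 15) * (t * (32 * (1 / t) ^ 29))"
    using E t q_pos by (intro mult_mono) (auto simp: t_def)
  also have "\<dots> = 64 / t ^ 13"
    using t by (simp add: power_one_over field_simps flip: power_add power_Suc)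
  also have "\<dots> < 1"
  proof -
    have "64 < t ^ 1" using t by simp
    also have "\<dots> \<le> t ^ 13" using t by (intro power_increasing) auto
    finally show ?thesis using t by (simp add: divide_less_eq)
  qed
  finally have "\<bar>real_of_int (dot m P)\<bar> < 1" using k by simp
  then have "dot m P = 0" by linarith
  then have dvd: "c0 P dvd c1 m * c2 w - c2 m * c1 w" by (rule flag_dvd[OF fl])
  have T5: "0 < T ^ 5" using T by simp
  have w: "\<bar>c2 w\<bar> \<le> 16 * T ^ 5" "\<bar>c1 w\<bar> \<le> 16 * T ^ 5"
    using sz T5 by (auto simp: sized_def)
  have "\<bar>c1 m * c2 w - c2 m * c1 w\<bar> \<le> \<bar>c1 m\<bar> * \<bar>c2 w\<bar> + \<bar>c2 m\<bar> * \<bar>c1 w\<bar>"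
    by (metis abs_mult abs_triangle_ineq4)
  also have "\<dots> \<le> \<bar>c1 m\<bar> * (16 * T ^ 5) + \<bar>c2 m\<bar> * (16 * T ^ 5)"
    using w by (intro add_mono mult_left_mono) auto
  also have "\<dots> = (\<bar>c1 m\<bar> + \<bar>c2 m\<bar>) * (16 * T ^ 5)" by (simp add: distrib_right)
  also have "\<dots> \<le> T * (T * T ^ 5)"
    using N T T5 by (intro mult_mono) auto
  also have "\<dots> = T ^ 7" by (simp flip: power_Suc)
  also have "\<dots> < T ^ 15" using T by (intro power_strict_increasing) auto
  finally have "\<bar>c1 m * c2 w - c2 m * c1 w\<bar> < c0 P" using q(1) by linarith
  then show ?thesis using dvd q_pos zdvd_not_zless[of "\<bar>c1 m * c2 w - c2 m * c1 w\<bar>" "c0 P"]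
    by auto
qed

section \<open>Assembly over all scales\<close>

lemma scale_gt: "int n < scale n"
proof -
  have "int n < 2 ^ n" by (rule of_nat_less_two_power)
  also have "\<dots> < 2 ^ (2 ^ n)" by (intro power_strict_increasing) auto
  also have "\<dots> \<le> 256 ^ (2 ^ n)" by (intro power_mono) auto
  finally show ?thesis by (simp add: scale_def)
qed

text \<open>The windows adjoin since \<open>scale n ^ 16 = scale (Suc n) ^ 8\<close>, and the first
  begins at \<open>2 ^ 64\<close>.\<close>

lemma ex_scale_window:
  assumes "2 ^ 200 \<le> M"
  shows "\<exists>n. scale n ^ 8 \<le> M \<and> M < scale n ^ 16"
proof -
  have "M < scale (nat M)" using scale_gt[of "nat M"] assms by simp
  also have "\<dots> \<le> scale (nat M) ^ 8" using scale_ge[of "nat M"] by (intro self_le_power) auto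
  finally have ex: "M < scale (nat M) ^ 8" .
  have 0: "\<not> M < scale 0 ^ 8" using assms by (simp add: scale_def)
  from ex_least_nat_less[of "\<lambda>n. M < scale n ^ 8", OF ex 0]
  obtain n where "\<forall>i\<le>n. \<not> M < scale i ^ 8" "M < scale (Suc n) ^ 8" by blast
  then show ?thesis by (auto simp: scale_Suc not_less intro!: exI[of _ n] simp flip: power_mult)
qed

lemma sigma_exp_ge: "19 / 10 \<le> sigma_exp"
  using sigma_root_exists sigma_greatest by fastforce

theorem theorem1:
  shows "\<exists>\<alpha>\<^sub>1 \<alpha>\<^sub>2 :: real.
    (\<forall>a b c :: int. of_int a + of_int b * \<alpha>\<^sub>1 + of_int c * \<alpha>\<^sub>2 = 0 \<longrightarrow> a = 0 \<and> b = 0 \<and> c = 0) \<and>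
    (\<forall>m\<^sub>1 m\<^sub>2 :: int. m\<^sub>1 \<ge> 0 \<longrightarrow> m\<^sub>2 \<ge> 0 \<longrightarrow> max m\<^sub>1 m\<^sub>2 \<ge> 2 ^ 200 \<longrightarrow>
       nearest_int_dist (of_int m\<^sub>1 * \<alpha>\<^sub>1 + of_int m\<^sub>2 * \<alpha>\<^sub>2)
         \<ge> 1 / (2 ^ 300 * of_int (max m\<^sub>1 m\<^sub>2) powr sigma_exp))"
proof -
  obtain w P P1 P2 where st: "\<And>n. state (scale n) (w n) (P n)"
    and li: "\<And>n. link (scale n) (w (Suc n)) (P n) (P1 n) (P2 n) (P (Suc n))"
    and indep: "\<And>n. c1 (w n) * c2 (w (Suc n)) \<noteq> c2 (w n) * c1 (w (Suc n))"
    using ex_state_sequence by blast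
  obtain \<alpha>\<^sub>1 where \<alpha>\<^sub>1:
    "\<And>n. \<alpha>\<^sub>1 - ratio c1 (P n) \<in> {(1 / scale n) ^ 29 / 2 .. 32 * (1 / scale n) ^ 29}"
    "\<And>n. \<alpha>\<^sub>1 - ratio c1 (P1 n) \<in> {(1 / scale n) ^ 40 / 2 .. 32 * (1 / scale n) ^ 40}"
    "\<And>n. \<alpha>\<^sub>1 - ratio c1 (P2 n) \<in> {(1 / scale n) ^ 46 / 2 .. 32 * (1 / scale n) ^ 46}"
    using ex_limit[OF st li, of c1] by blast
  obtain \<alpha>\<^sub>2 where \<alpha>\<^sub>2:
    "\<And>n. \<alpha>\<^sub>2 - ratio c2 (P n) \<in> {(1 / scale n) ^ 29 / 2 .. 32 * (1 / scale n) ^ 29}"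
    "\<And>n. \<alpha>\<^sub>2 - ratio c2 (P1 n) \<in> {(1 / scale n) ^ 40 / 2 .. 32 * (1 / scale n) ^ 40}"
    "\<And>n. \<alpha>\<^sub>2 - ratio c2 (P2 n) \<in> {(1 / scale n) ^ 46 / 2 .. 32 * (1 / scale n) ^ 46}"
    using ex_limit[OF st li, of c2] by blast
  have "a = 0 \<and> b = 0 \<and> c = 0" if L: "of_int a + of_int b * \<alpha>\<^sub>1 + of_int c * \<alpha>\<^sub>2 = 0" for a b c :: int
  proof -
    have par: "b * c2 (w n) = c * c1 (w n)" if n: "nat (\<bar>b\<bar> + \<bar>c\<bar>) \<le> n" for n
    proof -
      have "0 \<le> (1 / real_of_int (scale n)) ^ 29 / 2" using scale_ge[of n] by simp
      then have "\<alpha>\<^sub>1 - ratio c1 (P n) \<in> {0 .. 32 * (1 / scale n) ^ 29}"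
        "\<alpha>\<^sub>2 - ratio c2 (P n) \<in> {0 .. 32 * (1 / scale n) ^ 29}"
        using \<alpha>\<^sub>1(1)[of n] \<alpha>\<^sub>2(1)[of n] unfolding atLeastAtMost_iff by linarith+
      moreover have "\<bar>b\<bar> + \<bar>c\<bar> < scale n" using scale_gt[of n] n by linarith
      ultimately show ?thesis
        using vanishing_form_parallel[OF scale_ge st, of "IVec a b c" n \<alpha>\<^sub>1 \<alpha>\<^sub>2] L by simp
    qed
    define n where "n = nat (\<bar>b\<bar> + \<bar>c\<bar>)"
    have p: "b * c2 (w n) = c * c1 (w n)" "b * c2 (w (Suc n)) = c * c1 (w (Suc n))"
      using par by (auto simp: n_def)
    \<comment> \<open>Being parallel to two independent vectors forces
      \<open>b = c = 0\<close>.\<close>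
    have "b * (c1 (w n) * c2 (w (Suc n)) - c2 (w n) * c1 (w (Suc n))) = 0"
      "c * (c1 (w n) * c2 (w (Suc n)) - c2 (w n) * c1 (w (Suc n))) = 0"
      using p by algebra+
    then have "b = 0" "c = 0" using indep[of n] by auto
    then show ?thesis using L by simp
  qed
  moreover have "1 / (2 ^ 300 * of_int (max m\<^sub>1 m\<^sub>2) powr sigma_exp)
      \<le> nearest_int_dist (of_int m\<^sub>1 * \<alpha>\<^sub>1 + of_int m\<^sub>2 * \<alpha>\<^sub>2)"
    if m: "0 \<le> m\<^sub>1" "0 \<le> m\<^sub>2" "2 ^ 200 \<le> max m\<^sub>1 m\<^sub>2" for m\<^sub>1 m\<^sub>2 :: int
  proof -
    define M where "M = max m\<^sub>1 m\<^sub>2"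
    define m where "m = IVec (- round (of_int m\<^sub>1 * \<alpha>\<^sub>1 + of_int m\<^sub>2 * \<alpha>\<^sub>2)) m\<^sub>1 m\<^sub>2"
    have sel: "0 \<le> c1 m" "0 \<le> c2 m" "M = max (c1 m) (c2 m)" using m by (auto simp: m_def M_def)
    have dist: "nearest_int_dist (of_int m\<^sub>1 * \<alpha>\<^sub>1 + of_int m\<^sub>2 * \<alpha>\<^sub>2)
        = \<bar>of_int (c0 m) + of_int (c1 m) * \<alpha>\<^sub>1 + of_int (c2 m) * \<alpha>\<^sub>2\<bar>"
      by (simp add: nearest_int_dist_def m_def algebra_simps)
    obtain n where n: "scale n ^ 8 \<le> M" "M < scale n ^ 16"
      using ex_scale_window[OF m(3)] unfolding M_def by blast
    note lower = linear_form_lower_bound[OF scale_ge _ _ _ _ sel]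
    \<comment> \<open>The conditions of \<open>lower\<close> read \<open>28 < 29\<close>,
      \<open>150 <= 152\<close>, \<open>290 <= 290\<close>; then \<open>39 < 40\<close>,
      \<open>240 <= 247\<close>, \<open>400 <= 406\<close>; then \<open>42 < 46\<close>,
      \<open>260 <= 285\<close>, \<open>460 <= 464\<close>.\<close>
    consider "M < scale n ^ 13" | "scale n ^ 13 \<le> M" "M < scale n ^ 15" | "scale n ^ 15 \<le> M"
      by linarith
    then have "1 / (2 ^ 16 * real_of_int M powr (19 / 10))
        \<le> \<bar>of_int (c0 m) + of_int (c1 m) * \<alpha>\<^sub>1 + of_int (c2 m) * \<alpha>\<^sub>2\<bar>"
    proof cases
      case 1
      \<comment> \<open>At \<open>P n\<close> the old vector \<open>w n\<close> serves: its smaller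
        size \<open>T ^ 5\<close> gives \<open>k = 10\<close>, exactly what \<open>c = 29\<close>
        demands.\<close>
      show ?thesis
        by (rule lower[OF _ _ _ _ n(1) 1 \<alpha>\<^sub>1(1) \<alpha>\<^sub>2(1), where d = 5 and a = 15 and w = "w n" and k = 10])
          (use st[of n] in \<open>auto simp: state_def\<close>)
    next
      case 2
      show ?thesis
        by (rule lower[OF _ _ _ _ 2 \<alpha>\<^sub>1(2) \<alpha>\<^sub>2(2), where d = 10 and a = 24 and w = "w (Suc n)" and k = 14])
          (use li[of n] in \<open>auto simp: link_def\<close>)
    next
      case 3
      show ?thesis
        by (rule lower[OF _ _ _ _ 3 n(2) \<alpha>\<^sub>1(3) \<alpha>\<^sub>2(3), where d = 10 and a = 26 and w = "w (Suc n)" and k = 16])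
          (use li[of n] in \<open>auto simp: link_def\<close>)
    qed
    moreover have "1 / (2 ^ 300 * real_of_int M powr sigma_exp) \<le> 1 / (2 ^ 16 * of_int M powr (19 / 10))"
    proof -
      have "1 \<le> real_of_int M" using m(3) by (simp add: M_def)
      then have "of_int M powr (19 / 10) \<le> of_int M powr sigma_exp" "0 < real_of_int M"
        using sigma_exp_ge by (auto intro: powr_mono)
      then show ?thesis by (intro divide_left_mono mult_mono) auto
    qed
    ultimately show ?thesis unfolding dist M_def by linarith
  qed
  ultimately show ?thesis by blast
qed

end
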